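(* Let $d\ge2$ be an integer. For every $p\in\mathbb{R}$, every $f\in C_c^\infty(\mathbb{R}^{d-1}\times(0,\infty))$, every $k\in\mathbb{R}^{d-1}\setminus\{0\}$ and every $\theta\in(0,\pi/2)$, $$\Bigl(H_{\frac{d-3}{2}}\,F\,\bigl(y^{\frac{d-3}{2}-p}f\bigr)\Bigr)\bigl(k,|k|\tan\theta\bigr)=(2\pi)^{\frac{1-d}{2}}\,\frac{(\cos\theta)^{1-p}}{(\tan\theta)^{\frac{d-1}{2}}}\,|k|^{\frac{d-3}{2}}\,(F R^{(p)}f)(k,\theta).$$
   Context: Points of $\mathbb{R}^d$ are written $(x,y)$ with $x\in\mathbb{R}^{d-1}$, $y\in\mathbb{R}$. $C_c^\infty(\mathbb{R}^{d-1}\times(0,\infty))$ is the space of real-valued $C^\infty$ functions on $\mathbb{R}^d$ with compact support contained in $\mathbb{R}^{d-1}\times(0,\infty)$. $S^{d-2}$ is the unit sphere in $\mathbb{R}^{d-1}$ and $dn$ its surface measure (for $d=2$, $S^0=\{-1,1\}$ with counting measure). Conical Radon transform: for $p\in\mathbb{R}$, $u\in\mathbb{R}^{d-1}$, $\theta\in(0,\pi/2)$, $$(R^{(p)}f)(u,\theta)=\int_0^\infty\frac{1}{s^p}\int_{S^{d-2}}f\bigl(u+s\sin(\theta)\,n,\ s\cos(\theta)\bigr)\,(s\sin\theta)^{d-2}\,dn\,ds .$$ $y^{\frac{d-3}{2}-p}f$ is the function $(x,y)\mapsto y^{\frac{d-3}{2}-p}f(x,y)$ (zero where $f$ vanishes).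 $F$ is the Fourier transform in the first argument: $(Fh)(k,y)=\int_{\mathbb{R}^{d-1}}e^{-ik\cdot x}h(x,y)\,dx$ for functions $h$ on $\mathbb{R}^{d-1}\times\mathbb{R}$, and likewise $(Fg)(k,\theta)=\int_{\mathbb{R}^{d-1}}e^{-ik\cdot u}g(u,\theta)\,du$ for functions $g$ on $\mathbb{R}^{d-1}\times(0,\pi/2)$. $H_{(d-3)/2}$ is the Hankel transform of order $(d-3)/2$ in the second argument: $(H_{(d-3)/2}h)(k,\lambda)=\int_0^\infty J_{(d-3)/2}(y\lambda)\,h(k,y)\,y\,dy$ for $(k,\lambda)\in\mathbb{R}^{d-1}\times(0,\infty)$, where $J_{(d-3)/2}$ is the Bessel function of the first kind of order $(d-3)/2$ (for $d=2$, $J_{-1/2}(t)=\sqrt{2/(\pi t)}\cos t$). *)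

theory Defs
  imports "HOL-Analysis.Analysis"
begin

section \<open>Test functions on the upper half space\<close>

text \<open>On a finite-dimensional domain \<open>C_diff n f\<close> says that \<open>f\<close> is of class \<open>C\<^sup>n\<close>: \<open>f\<close> is Frechet
  differentiable and all its directional derivatives are of class \<open>C\<^sup>n\<^sup>-\<^sup>1\<close>.\<close>

primrec C_diff :: "nat \<Rightarrow> ('a::real_normed_vector \<Rightarrow> 'b::real_normed_vector) \<Rightarrow> bool" where
  "C_diff 0 f \<longleftrightarrow> continuous_on UNIV f"
| "C_diff (Suc n) f \<longleftrightarrow>
     (\<forall>x. f differentiable (at x)) \<and> (\<forall>v. C_diff n (\<lambda>x. frechet_derivative f (at x) v))"

definition smooth :: "('a::real_normed_vector \<Rightarrow> 'b::real_normed_vector) \<Rightarrow> bool" where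
  "smooth f \<longleftrightarrow> (\<forall>n. C_diff n f)"

definition test_functions :: "'a::real_normed_vector set \<Rightarrow> ('a \<Rightarrow> real) set" where
  "test_functions U =
     {f. smooth f \<and> compact (closure {z. f z \<noteq> 0}) \<and> closure {z. f z \<noteq> 0} \<subseteq> U}"

section \<open>Surface measure on the unit sphere\<close>

text \<open>The \<open>(N - 1)\<close>-dimensional surface measure of a Borel set \<open>A\<close> of unit vectors in an
  \<open>N\<close>-dimensional space is \<open>N\<close> times the Lebesgue measure of the cone
  \<open>{r n | 0 < r \<le> 1, n \<in> A}\<close>; see \<open>emeasure_sphere_measure\<close> below. Here \<open>sgn x = x / |x|\<close>.
  For \<open>N = 1\<close> this is the counting measure on \<open>{-1, 1}\<close>.\<close>

definition sphere_measure :: "'a::euclidean_space measure" where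
  "sphere_measure =
     scale_measure (of_nat DIM('a))
       (distr (restrict_space lborel (cball 0 1 - {0})) (restrict_space borel (sphere 0 1)) sgn)"

lemma space_sphere_measure: "space sphere_measure = sphere (0::'a::euclidean_space) 1"
  by (simp add: sphere_measure_def space_scale_measure space_restrict_space)

lemma emeasure_sphere_measure:
  fixes A :: "'a::euclidean_space set"
  assumes "A \<in> sets borel" "A \<subseteq> sphere 0 1"
  shows "emeasure sphere_measure A =
           of_nat DIM('a) * emeasure lborel {x. 0 < norm x \<and> norm x \<le> 1 \<and> sgn x \<in> A}"
proof -
  have m: "sgn \<in> measurable (restrict_space lborel (cball 0 1 - {0}))
                    (restrict_space borel (sphere (0::'a) 1))"
    by (rule measurable_restrict_space2)
       (auto simp: space_restrict_space norm_sgn sgn_div_norm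
             intro!: measurable_restrict_space1 borel_measurable_scaleR)
  have "A \<in> sets (restrict_space borel (sphere (0::'a) 1))"
    using assms by (auto simp: sets_restrict_space_iff)
  moreover have "sgn -` A \<inter> (cball 0 1 - {0}) = {x. 0 < norm x \<and> norm x \<le> 1 \<and> sgn x \<in> A}"
    by auto
  moreover have "emeasure (restrict_space lborel (cball 0 1 - {0})) C = emeasure lborel C"
    if "C \<subseteq> cball 0 1 - {0}" for C :: "'a set"
    using that by (intro emeasure_restrict_space) auto
  ultimately show ?thesis
    using m by (simp add: sphere_measure_def emeasure_distr space_restrict_space subset_iff)
qed

lemma emeasure_sphere_measure_real:
  "emeasure (sphere_measure :: real measure) {1} = 1"
  "emeasure (sphere_measure :: real measure) {-1} = 1"
proof -
  have "{x::real. 0 < norm x \<and> norm x \<le> 1 \<and> sgn x \<in> {1}} = {0<..1}"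
    "{x::real. 0 < norm x \<and> norm x \<le> 1 \<and> sgn x \<in> {-1}} = {-1..<0}"
    by (auto simp: sgn_if split: if_splits)
  then show "emeasure (sphere_measure :: real measure) {1} = 1"
    "emeasure (sphere_measure :: real measure) {-1} = 1"
    by (subst emeasure_sphere_measure; simp)+
qed

section \<open>The transforms\<close>

text \<open>For a point \<open>u\<close> of a space of dimension \<open>d - 1\<close> we have \<open>DIM('a) - 1 = d - 2\<close>.\<close>

definition conical_radon ::
  "real \<Rightarrow> ('a::euclidean_space \<times> real \<Rightarrow> real) \<Rightarrow> 'a \<times> real \<Rightarrow> real" where
  "conical_radon p f = (\<lambda>(u, \<theta>).
     LBINT s:{0<..}. 1 / s powr p *
       (LINT n|sphere_measure.
          f (u + (s * sin \<theta>) *\<^sub>R n, s * cos \<theta>) * (s * sin \<theta>) ^ (DIM('a) - 1)))"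

definition fourier1 ::
  "('a::euclidean_space \<times> real \<Rightarrow> complex) \<Rightarrow> 'a \<times> real \<Rightarrow> complex" where
  "fourier1 h = (\<lambda>(k, y). LBINT x. exp (- \<i> * complex_of_real (k \<bullet> x)) * h (x, y))"

text \<open>The power series of the Bessel function of the first kind, for arguments \<open>t > 0\<close>;
  \<open>rGamma\<close> is the reciprocal of the Gamma function, extended by \<open>0\<close> at its poles.\<close>

definition bessel_J :: "real \<Rightarrow> real \<Rightarrow> real" where
  "bessel_J \<nu> t =
     (\<Sum>m. (-1) ^ m / fact m * rGamma (real m + \<nu> + 1) * (t / 2) powr (2 * real m + \<nu>))"

lemma bessel_J_minus_half:
  assumes "t > 0"
  shows "bessel_J (- 1 / 2) t = sqrt (2 / (pi * t)) * cos t"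
proof -
  have rG: "rGamma (real m + 1 / 2) = 4 ^ m * fact m / (fact (2 * m) * sqrt pi)" for m
  proof (induction m)
    case 0
    show ?case by (simp add: rGamma_inverse_Gamma Gamma_one_half_real field_simps)
  next
    case (Suc m)
    have "(real m + 1 / 2) * rGamma (real (Suc m) + 1 / 2) = rGamma (real m + 1 / 2)"
      using rGamma_plus1[of "real m + 1 / 2"] by (simp add: algebra_simps)
    then have "rGamma (real (Suc m) + 1 / 2) = rGamma (real m + 1 / 2) / (real m + 1 / 2)"
      by (simp add: field_simps)
    also have "\<dots> = 4 ^ Suc m * fact (Suc m) / (fact (2 * Suc m) * sqrt pi)"
    proof -
      have cancel: "A / (B * C) / w = (4 * u) * A / ((2 * u) * (2 * w) * B * C)"
        if "u \<noteq> 0" for A B C u w :: real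
        using that by (simp add: mult.assoc)
      have 1: "(fact (2 * Suc m)::real) = (2 * (real m + 1)) * (2 * (real m + 1 / 2)) * fact (2 * m)"
        by (simp add: algebra_simps)
      have 2: "(4::real) ^ Suc m * fact (Suc m) = (4 * (real m + 1)) * (4 ^ m * fact m)"
        by (simp add: algebra_simps)
      show ?thesis
        unfolding Suc.IH 1 2 by (rule cancel) simp
    qed
    finally show ?case .
  qed
  have pw: "(t / 2) powr (2 * real m - 1 / 2) = (t / 2) ^ (2 * m) * sqrt (2 / t)" for m
  proof -
    have "(t / 2) powr (2 * real m - 1 / 2) = (t / 2) powr real (2 * m) / (t / 2) powr (1 / 2)"
      by (simp add: powr_diff)
    also have "(t / 2) powr real (2 * m) = (t / 2) ^ (2 * m)"
      using assms by (intro powr_realpow) simp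
    also have "(t / 2) powr (1 / 2) = sqrt (t / 2)"
      using assms by (intro powr_half_sqrt) simp
    also have "(t / 2) ^ (2 * m) / sqrt (t / 2) = (t / 2) ^ (2 * m) * sqrt (2 / t)"
      by (simp add: real_sqrt_divide)
    finally show ?thesis .
  qed
  have eq: "(-1) ^ m / fact m * rGamma (real m + - 1 / 2 + 1) * (t / 2) powr (2 * real m + - 1 / 2)
      = sqrt (2 / (pi * t)) * ((-1) ^ m / fact (2 * m) * t ^ (2 * m))" for m
  proof -
    have a: "real m + - 1 / 2 + 1 = real m + 1 / 2" by simp
    have b: "2 * real m + - 1 / 2 = 2 * real m - 1 / 2" by simp
    have c: "(4::real) ^ m = 2 ^ (2 * m)" by (simp add: power_mult)
    show ?thesis
      unfolding a b rG pw c power_divide real_sqrt_divide real_sqrt_mult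
      by (simp add: mult_ac)
  qed
  have "(\<lambda>n. (-1) ^ n / fact (2 * n) * t ^ (2 * n)) sums cos t"
    using cos_paired[of t] by simp
  then have "(\<lambda>n. sqrt (2 / (pi * t)) * ((-1) ^ n / fact (2 * n) * t ^ (2 * n)))
      sums (sqrt (2 / (pi * t)) * cos t)"
    by (rule sums_mult)
  then show ?thesis
    unfolding bessel_J_def eq by (rule sums_unique[symmetric])
qed

definition hankel ::
  "real \<Rightarrow> ('a \<times> real \<Rightarrow> complex) \<Rightarrow> 'a \<times> real \<Rightarrow> complex" where
  "hankel \<nu> h = (\<lambda>(k, t).
     LBINT y:{0<..}. complex_of_real (bessel_J \<nu> (y * t)) * h (k, y) * complex_of_real y)"

end

theory Submission
  imports Defs "HOL-Complex_Analysis.Cauchy_Integral_Formula"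
begin

text \<open>Let \<open>N = d - 1\<close> be the dimension of the horizontal variable and \<open>\<nu> = N / 2 - 1 = (d - 3) / 2\<close>.
  The conical Radon transform at \<open>(u, \<theta>)\<close> superposes the translates of \<open>f (\<cdot>, s cos \<theta>)\<close> by the
  vectors \<open>(s sin \<theta>) n\<close> with \<open>n\<close> on the unit sphere. The Fourier transform in \<open>u\<close> turns each translation
  into a phase, so after Fubini (\<open>fourier_conical_radon\<close>) the sphere enters only through the Fourier
  transform of its surface measure, a Bessel function (\<open>sphere_fourier\<close>):

    \<open>\<integral> exp (i k \<bullet> n) dn = (2 \<pi>)\<^sup>N\<^sup>/\<^sup>2 |k|\<^sup>-\<^sup>\<nu> J\<^sub>\<nu>(|k|)\<close>.

  The remaining integral over \<open>s\<close> becomes a Hankel transform under the substitution \<open>y = s cos \<theta>\<close>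
  (\<open>fourier_conical_radon_bessel\<close>), and the theorem follows by counting powers.

  The formula for the sphere comes from the power series. By parity only the cosine series
  contributes, so it suffices to know \<open>\<integral> (k \<bullet> n)\<^sup>2\<^sup>m dn\<close> (\<open>nn_integral_sphere_inner_power\<close>). Polar
  coordinates (\<open>nn_integral_polar\<close>) relate this number to the moment
  \<open>\<integral> (k \<bullet> x)\<^sup>2\<^sup>m exp (- |x|\<^sup>2) dx\<close> of a Gaussian. All these moments are read off at once from the
  generating function \<open>\<integral> cosh (2 t (k \<bullet> x)) exp (- |x|\<^sup>2) dx = \<pi>\<^sup>N\<^sup>/\<^sup>2 exp (t\<^sup>2 |k|\<^sup>2)\<close>, which is
  translation invariance of Lebesgue measure after completing the square. Polar coordinates are needed
  only for products of a function of \<open>sgn x\<close> and a function of \<open>|x|\<close>, where they amount to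
  uniqueness of a measure on the line that is known on all rays.\<close>

section \<open>Polar coordinates\<close>

lemma sets_sphere_measure:
  "sets (sphere_measure :: 'a::euclidean_space measure) = sets (restrict_space borel (sphere 0 1))"
  by (simp add: sphere_measure_def)

lemma measurable_sphere_measure [measurable (raw)]:
  fixes f :: "'a::euclidean_space \<Rightarrow> 'b"
  assumes "f \<in> measurable borel M"
  shows "f \<in> measurable sphere_measure M"
  using measurable_restrict_space1[OF assms]
  by (simp add: measurable_cong_sets[OF sets_sphere_measure refl])

lemma borel_measurable_sgn_euclidean [measurable]:
  "(sgn :: 'a::euclidean_space \<Rightarrow> 'a) \<in> borel_measurable borel"
  unfolding sgn_div_norm by measurable

lemma nn_integral_sphere_measure:
  fixes q :: "'a::euclidean_space \<Rightarrow> ennreal"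
  assumes [measurable]: "q \<in> borel_measurable borel"
  shows "(\<integral>\<^sup>+n. q n \<partial>sphere_measure)
           = of_nat DIM('a) * (\<integral>\<^sup>+x. q (sgn x) * indicator (cball 0 1) x \<partial>lborel)"
proof -
  have sgn_meas: "sgn \<in> measurable (restrict_space lborel (cball 0 1 - {0}))
                    (restrict_space borel (sphere (0::'a) 1))"
    by (rule measurable_restrict_space2)
       (auto simp: space_restrict_space norm_sgn sgn_div_norm
             intro!: measurable_restrict_space1 borel_measurable_scaleR)
  have "(\<integral>\<^sup>+n. q n \<partial>sphere_measure)
      = of_nat DIM('a) * (\<integral>\<^sup>+x. q (sgn x) \<partial>restrict_space lborel (cball 0 1 - {0}))"
    unfolding sphere_measure_def
    by (simp add: nn_integral_scale_measure measurable_restrict_space1 nn_integral_distr[OF sgn_meas])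
  also have "(\<integral>\<^sup>+x. q (sgn x) \<partial>restrict_space lborel (cball 0 1 - {0}))
      = (\<integral>\<^sup>+x. q (sgn x) * indicator (cball 0 1 - {0}) x \<partial>lborel)"
    by (subst nn_integral_restrict_space) auto
  also have "\<dots> = (\<integral>\<^sup>+x. q (sgn x) * indicator (cball 0 1) x \<partial>lborel)"
    by (intro nn_integral_cong_AE AE_I[of _ _ "{0}"]) (auto simp: indicator_def)
  finally show ?thesis .
qed

lemma emeasure_sphere_measure_space:
  "emeasure sphere_measure (space (sphere_measure :: 'a::euclidean_space measure))
     = ennreal (DIM('a) * unit_ball_vol DIM('a))"
proof -
  have "emeasure sphere_measure (space (sphere_measure :: 'a measure))
      = (\<integral>\<^sup>+n. 1 \<partial>(sphere_measure :: 'a measure))"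
    by simp
  also have "\<dots> = of_nat DIM('a) * emeasure lborel (cball (0::'a) 1)"
    by (subst nn_integral_sphere_measure) auto
  also have "\<dots> = ennreal (DIM('a) * unit_ball_vol DIM('a))"
    by (simp add: emeasure_cball ennreal_mult' ennreal_of_nat_eq_real_of_nat)
  finally show ?thesis .
qed

lemma finite_measure_sphere_measure: "finite_measure (sphere_measure :: 'a::euclidean_space measure)"
  by (rule finite_measureI) (simp add: emeasure_sphere_measure_space)

lemma measurable_uminus_sphere_measure:
  "uminus \<in> measurable sphere_measure (sphere_measure :: 'a::euclidean_space measure)"
proof -
  have "uminus \<in> measurable (restrict_space borel (sphere 0 1)) (restrict_space borel (sphere (0::'a) 1))"
    by (intro measurable_restrict_space3) auto
  then show ?thesis
    by (simp add: measurable_cong_sets[OF sets_sphere_measure sets_sphere_measure])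
qed

text \<open>The antipodal map preserves the surface measure because \<open>x \<mapsto> - x\<close> preserves Lebesgue measure
  and maps the cone over \<open>A\<close> onto the cone over \<open>- A\<close>.\<close>

lemma sphere_measure_uminus:
  "distr sphere_measure sphere_measure uminus = (sphere_measure :: 'a::euclidean_space measure)"
proof (rule measure_eqI)
  fix A :: "'a set" assume "A \<in> sets (distr sphere_measure sphere_measure uminus)"
  then have "A \<in> sets (restrict_space borel (sphere 0 1))"
    by (simp add: sets_sphere_measure)
  then have A[measurable]: "A \<in> sets borel" and A': "A \<subseteq> sphere 0 1"
    by (auto simp: sets_restrict_space_iff)
  have neg: "(uminus :: 'a \<Rightarrow> 'a) -` A \<inter> space sphere_measure = uminus -` A"
    using A' by (auto simp: space_sphere_measure dist_norm)
  have B[measurable]: "(uminus :: 'a \<Rightarrow> 'a) -` A \<in> sets borel"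
    using measurable_sets[of "uminus :: 'a \<Rightarrow> 'a" borel borel A] by simp
  have "emeasure (distr sphere_measure sphere_measure uminus) A = emeasure sphere_measure (uminus -` A)"
    using A A' by (subst emeasure_distr[OF measurable_uminus_sphere_measure]) (auto simp: sets_sphere_measure sets_restrict_space_iff neg)
  also have "\<dots> = of_nat DIM('a) * emeasure lborel {x. 0 < norm x \<and> norm x \<le> 1 \<and> sgn x \<in> uminus -` A}"
    using A' by (intro emeasure_sphere_measure B) (auto simp: dist_norm)
  also have "emeasure lborel {x. 0 < norm x \<and> norm x \<le> 1 \<and> sgn x \<in> uminus -` A}
      = emeasure lborel (uminus -` {x. 0 < norm x \<and> norm x \<le> 1 \<and> sgn x \<in> A})"
    by (simp add: vimage_def sgn_minus)
  also have "\<dots> = emeasure (distr lborel borel uminus) {x. 0 < norm x \<and> norm x \<le> 1 \<and> sgn x \<in> A}"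
    by (subst emeasure_distr) auto
  also have "distr lborel borel uminus = (lborel :: 'a measure)"
    using lborel_affine[of "-1" "0 :: 'a"] by (simp add: density_1)
  also have "of_nat DIM('a) * emeasure lborel {x. 0 < norm x \<and> norm x \<le> 1 \<and> sgn x \<in> A}
      = emeasure sphere_measure A"
    using A A' by (intro emeasure_sphere_measure[symmetric])
  finally show "emeasure (distr sphere_measure sphere_measure uminus) A = emeasure sphere_measure A" .
qed simp

text \<open>The function \<open>q (sgn x)\<close> is homogeneous of degree \<open>0\<close>, so the dilation \<open>x \<mapsto> a x\<close> reduces the
  ball of radius \<open>a\<close> to the unit ball, whose integral defines the surface measure. As a function
  of \<open>a\<close>, the integral over the ball is thus \<open>a\<^sup>N / N\<close> times the integral over the sphere.\<close>

lemma nn_integral_sphere_cball: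
  fixes q :: "'a::euclidean_space \<Rightarrow> ennreal"
  assumes [measurable]: "q \<in> borel_measurable borel" and "a > 0"
  shows "of_nat DIM('a) * (\<integral>\<^sup>+x. q (sgn x) * indicator (cball 0 a) x \<partial>lborel)
           = ennreal (a ^ DIM('a)) * (\<integral>\<^sup>+n. q n \<partial>sphere_measure)"
proof -
  have [measurable]: "cball (0::'a) a \<in> sets borel" by simp
  have "(\<integral>\<^sup>+x. q (sgn x) * indicator (cball 0 a) x \<partial>lborel)
      = (\<integral>\<^sup>+x. q (sgn x) * indicator (cball 0 a) x
            \<partial>density (distr lborel borel (\<lambda>x. 0 + a *\<^sub>R x)) (\<lambda>_. ennreal (\<bar>a\<bar> ^ DIM('a))))"
    using lborel_affine[of a "0::'a"] \<open>a > 0\<close> by simp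
  also have "\<dots> = ennreal (a ^ DIM('a)) * (\<integral>\<^sup>+x. q (sgn (a *\<^sub>R x)) * indicator (cball 0 a) (a *\<^sub>R x) \<partial>lborel)"
    using \<open>a > 0\<close>
    by (simp add: nn_integral_density nn_integral_distr nn_integral_cmult del: add_0) simp
  also have "(\<lambda>x::'a. q (sgn (a *\<^sub>R x)) * indicator (cball 0 a) (a *\<^sub>R x))
      = (\<lambda>x. q (sgn x) * indicator (cball 0 1) x)"
    using \<open>a > 0\<close> by (auto simp: fun_eq_iff sgn_scaleR indicator_def field_simps)
  finally show ?thesis
    by (simp add: nn_integral_sphere_measure mult_ac)
qed

text \<open>For fixed \<open>q\<close>, both sides are integrals of \<open>\<phi>\<close>: on the left against the image \<open>L\<close> under the norm of
  Lebesgue measure with density \<open>q (sgn x)\<close>, on the right against the measure \<open>R\<close> on the half line with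
  density a multiple of \<open>r\<^sup>N\<^sup>-\<^sup>1\<close>. By the previous lemma the two measures agree on all rays \<open>{..a}\<close>,
  and are finite there, hence they coincide. Integrands of the product form \<open>q (sgn x) \<phi> (norm x)\<close>
  suffice for homogeneous polynomials times radial functions.\<close>

lemma nn_integral_polar:
  fixes q :: "'a::euclidean_space \<Rightarrow> ennreal" and \<phi> :: "real \<Rightarrow> ennreal"
  assumes [measurable]: "q \<in> borel_measurable borel" "\<phi> \<in> borel_measurable borel"
    and fin: "(\<integral>\<^sup>+n. q n \<partial>sphere_measure) < \<infinity>"
  shows "(\<integral>\<^sup>+x. q (sgn x) * \<phi> (norm x) \<partial>lborel)
           = (\<integral>\<^sup>+n. q n \<partial>sphere_measure)
             * (\<integral>\<^sup>+r. \<phi> r * ennreal (r ^ (DIM('a) - 1)) * indicator {0..} r \<partial>lborel)"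
proof -
  define Q where "Q = (\<integral>\<^sup>+n. q n \<partial>(sphere_measure :: 'a measure))"
  define L where "L = distr (density lborel (\<lambda>x::'a. q (sgn x))) borel norm"
  define R where "R = density lborel (\<lambda>r. Q * (ennreal (r ^ (DIM('a) - 1)) * indicator {0..} r))"
  have L_Iic: "emeasure L {..a} = (\<integral>\<^sup>+(x::'a). q (sgn x) * indicator (cball 0 a) x \<partial>lborel)" for a
  proof -
    have "norm -` {..a} = cball (0::'a) a" by auto
    then show ?thesis
      unfolding L_def by (subst emeasure_distr) (simp_all add: emeasure_density)
  qed
  have eq: "emeasure L {..a} = emeasure R {..a} \<and> emeasure L {..a} < \<infinity>" for a
  proof -
    have R: "emeasure R {..a} = Q * (\<integral>\<^sup>+r. ennreal (r ^ (DIM('a) - 1)) * indicator {0..a} r \<partial>lborel)"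
      unfolding R_def by (subst emeasure_density)
        (auto simp: nn_integral_cmult[symmetric] intro!: nn_integral_cong split: split_indicator)
    consider "a < 0" | "a = 0" | "a > 0" by linarith
    then show ?thesis
    proof cases
      case 1
      then show ?thesis unfolding R L_Iic by simp
    next
      case 2
      have "(\<integral>\<^sup>+x. q (sgn x) * indicator (cball 0 0) x \<partial>lborel) = (\<integral>\<^sup>+(x::'a). 0 \<partial>lborel)"
        by (intro nn_integral_cong_AE AE_I[of _ _ "{0}"]) (auto simp: indicator_def)
      moreover have "(\<integral>\<^sup>+r. ennreal (r ^ (DIM('a) - 1)) * indicator {0..0} r \<partial>lborel) = (\<integral>\<^sup>+(r::real). 0 \<partial>lborel)"
        by (intro nn_integral_cong_AE AE_I[of _ _ "{0}"]) (auto simp: indicator_def)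
      ultimately show ?thesis unfolding R L_Iic unfolding 2 by simp
    next
      case 3
      have "(\<integral>\<^sup>+r. ennreal (r ^ (DIM('a) - 1)) * indicator {0..a} r \<partial>lborel)
          = ennreal (a ^ DIM('a) / DIM('a) - 0 ^ DIM('a) / DIM('a))"
      proof (rule nn_integral_FTC_Icc)
        fix r assume "r \<in> {0..a}"
        show "((\<lambda>r. r ^ DIM('a) / DIM('a)) has_real_derivative r ^ (DIM('a) - 1)) (at r)"
          by (auto intro!: derivative_eq_intros)
      qed (use 3 in auto)
      then have Rint: "emeasure R {..a} = Q * ennreal (a ^ DIM('a) / DIM('a))"
        unfolding R by (simp add: power_0_left)
      have D: "of_nat DIM('a) * emeasure L {..a} = ennreal (a ^ DIM('a)) * Q"
        unfolding L_Iic Q_def using 3 by (intro nn_integral_sphere_cball) auto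
      have "of_nat DIM('a) * emeasure R {..a} = (of_nat DIM('a) * ennreal (a ^ DIM('a) / DIM('a))) * Q"
        unfolding Rint by (simp add: mult_ac)
      also have "of_nat DIM('a) * ennreal (a ^ DIM('a) / DIM('a)) = ennreal (a ^ DIM('a))"
        using 3 by (simp add: ennreal_of_nat_eq_real_of_nat ennreal_mult'[symmetric])
      finally have E: "of_nat DIM('a) * emeasure L {..a} = of_nat DIM('a) * emeasure R {..a}"
        using D by simp
      then have "emeasure L {..a} = emeasure R {..a}"
        by (subst (asm) ennreal_mult_cancel_left) (auto simp: ennreal_of_nat_eq_real_of_nat)
      moreover have "emeasure R {..a} < \<infinity>"
        unfolding Rint using fin by (auto simp: Q_def ennreal_mult_less_top)
      ultimately show ?thesis by simp
    qed
  qed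
  have "L = R"
  proof (rule measure_eqI_generator_eq)
    show "Int_stable (range (\<lambda>a::real. {..a}))"
      by (auto simp: Int_stable_def)
    show "range (\<lambda>a::real. {..a}) \<subseteq> Pow UNIV" by auto
    show "emeasure L X = emeasure R X" if "X \<in> range (\<lambda>a::real. {..a})" for X
      using that eq by auto
    show "sets L = sigma_sets UNIV (range (\<lambda>a::real. {..a}))"
      "sets R = sigma_sets UNIV (range (\<lambda>a::real. {..a}))"
      by (simp_all add: L_def R_def borel_eq_atMost)
    show "range (\<lambda>i::nat. {..real i}) \<subseteq> range (\<lambda>a::real. {..a})" by auto
    show "(\<Union>i::nat. {..real i}) = UNIV" by (auto simp: real_arch_simple)
    show "emeasure L {..real i} \<noteq> \<infinity>" for i using eq[of "real i"] by auto
  qed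
  have "(\<integral>\<^sup>+x. q (sgn x) * \<phi> (norm x) \<partial>lborel) = (\<integral>\<^sup>+r. \<phi> r \<partial>L)"
    unfolding L_def by (subst nn_integral_distr) (auto simp: nn_integral_density)
  also have "\<dots> = (\<integral>\<^sup>+r. \<phi> r \<partial>R)" by (simp add: \<open>L = R\<close>)
  also have "\<dots> = Q * (\<integral>\<^sup>+r. \<phi> r * ennreal (r ^ (DIM('a) - 1)) * indicator {0..} r \<partial>lborel)"
    unfolding R_def by (subst nn_integral_density) (auto simp: nn_integral_cmult[symmetric] mult_ac)
  finally show ?thesis unfolding Q_def .
qed

section \<open>Gaussian integrals\<close>

text \<open>The substitution \<open>t = r\<^sup>2\<close> turns Euler's integral for the Gamma function into this moment. It is
  made on the open half line since \<open>0 powr a = 0\<close>: for \<open>n = 0\<close> the transformed integrand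
  \<open>2 r (r\<^sup>2) powr (- 1 / 2) exp (- r\<^sup>2)\<close> vanishes at \<open>r = 0\<close>, unlike \<open>2 exp (- r\<^sup>2)\<close>.\<close>

lemma nn_integral_radial_gaussian_moment:
  "(\<integral>\<^sup>+r. ennreal (exp (- (r\<^sup>2))) * ennreal (r ^ n) * indicator {0..} r \<partial>lborel)
     = ennreal (Gamma ((real n + 1) / 2) / 2)"
proof -
  define s where "s = (real n + 1) / 2"
  have s: "s > 0" by (simp add: s_def)
  have "((\<lambda>t. t powr (s - 1) / exp t) has_integral Gamma s) {0..}"
    by (rule Gamma_integral_real[OF s])
  then have *: "((\<lambda>t. t powr (s - 1) / exp t) has_integral Gamma s) {0<..}"
    by (subst has_integral_spike_set_eq[of _ "{0..}"]) (auto intro: negligible_subset[of "{0}"])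
  have "(\<lambda>t. t powr (s - 1) / exp t) absolutely_integrable_on {0<..}"
    using * by (intro nonnegative_absolutely_integrable_1) auto
  moreover have "(\<lambda>r::real. r\<^sup>2) ` {0<..} = {0<..}"
  proof (intro equalityI subsetI)
    fix t :: real assume "t \<in> {0<..}"
    then show "t \<in> (\<lambda>r. r\<^sup>2) ` {0<..}" by (intro image_eqI[of _ _ "sqrt t"]) auto
  qed auto
  ultimately have "(\<lambda>r. \<bar>2 * r\<bar> * ((r\<^sup>2) powr (s - 1) / exp (r\<^sup>2))) absolutely_integrable_on {0<..} \<and>
      integral {0<..} (\<lambda>r. \<bar>2 * r\<bar> * ((r\<^sup>2) powr (s - 1) / exp (r\<^sup>2))) = Gamma s"
    using *
    by (subst has_absolute_integral_change_of_variables_1'[where g = "\<lambda>r. r\<^sup>2" and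
          f = "\<lambda>t. t powr (s - 1) / exp t"])
       (auto intro!: derivative_eq_intros inj_onI simp: integral_unique power2_eq_iff)
  then have "((\<lambda>r. \<bar>2 * r\<bar> * ((r\<^sup>2) powr (s - 1) / exp (r\<^sup>2))) has_integral Gamma s) {0<..}"
    by (metis integrable_integral set_lebesgue_integral_eq_integral(1))
  then have "((\<lambda>r. exp (- (r\<^sup>2)) * r ^ n) has_integral Gamma s / 2) {0<..}"
  proof (rule has_integral_eq[OF _ has_integral_divide, rotated])
    fix r :: real assume "r \<in> {0<..}"
    then have r: "r > 0" by simp
    have "(r\<^sup>2) powr (s - 1) = r powr (2 * (s - 1))"
      using r powr_powr[of r 2 "s - 1"] by simp
    also have "2 * (s - 1) = real n - 1" by (simp add: s_def)
    also have "r powr (real n - 1) = r ^ n / r"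
      using r by (simp add: powr_diff powr_realpow)
    finally show "\<bar>2 * r\<bar> * ((r\<^sup>2) powr (s - 1) / exp (r\<^sup>2)) / 2 = exp (- (r\<^sup>2)) * r ^ n"
      using r by (simp add: exp_minus field_simps)
  qed
  then have "(\<integral>\<^sup>+r. ennreal (indicator {0<..} r * (exp (- (r\<^sup>2)) * r ^ n)) \<partial>lborel) = ennreal (Gamma s / 2)"
    by (rule nn_integral_has_integral_lebesgue[rotated]) auto
  also have "(\<integral>\<^sup>+r. ennreal (indicator {0<..} r * (exp (- (r\<^sup>2)) * r ^ n)) \<partial>lborel)
      = (\<integral>\<^sup>+r. ennreal (exp (- (r\<^sup>2))) * ennreal (r ^ n) * indicator {0..} r \<partial>lborel)"
    by (intro nn_integral_cong_AE AE_I[of _ _ "{0}"])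
       (auto simp: indicator_def ennreal_mult' split: if_splits)
  finally show ?thesis by (simp add: s_def)
qed

text \<open>Polar coordinates with \<open>q = 1\<close> give \<open>\<Gamma>(N/2) / 2\<close> times the area of the sphere, which is \<open>N\<close> times the volume
  of the unit ball; the Gamma functions cancel by \<open>\<Gamma>(N/2 + 1) = (N/2) \<Gamma>(N/2)\<close>.\<close>

lemma nn_integral_gaussian:
  "(\<integral>\<^sup>+x. ennreal (exp (- (norm x)\<^sup>2)) \<partial>(lborel :: 'a::euclidean_space measure))
     = ennreal (pi powr (DIM('a) / 2))"
proof -
  have sph: "(\<integral>\<^sup>+(n::'a). 1 \<partial>(sphere_measure :: 'a measure)) = ennreal (DIM('a) * unit_ball_vol DIM('a))"
    by (simp add: emeasure_sphere_measure_space)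
  have "(\<integral>\<^sup>+x. ennreal (exp (- (norm x)\<^sup>2)) \<partial>(lborel :: 'a measure))
      = (\<integral>\<^sup>+n. 1 \<partial>(sphere_measure :: 'a measure))
        * (\<integral>\<^sup>+r. ennreal (exp (- r\<^sup>2)) * ennreal (r ^ (DIM('a) - 1)) * indicator {0..} r \<partial>lborel)"
    using nn_integral_polar[of "\<lambda>_::'a. 1" "\<lambda>r. ennreal (exp (- r\<^sup>2))"] unfolding sph by simp
  also have "\<dots> = ennreal (DIM('a) * unit_ball_vol DIM('a)) * ennreal (Gamma (DIM('a) / 2) / 2)"
    unfolding sph nn_integral_radial_gaussian_moment by (simp add: of_nat_diff Suc_leI)
  also have "\<dots> = ennreal (DIM('a) * unit_ball_vol DIM('a) * (Gamma (DIM('a) / 2) / 2))"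
    by (intro ennreal_mult[symmetric]) (auto intro!: Gamma_real_nonneg)
  also have "DIM('a) * unit_ball_vol DIM('a) * (Gamma (DIM('a) / 2) / 2) = pi powr (DIM('a) / 2)"
  proof -
    have pos: "real DIM('a) / 2 > 0" by simp
    then have "real DIM('a) / 2 \<notin> \<int>\<^sub>\<le>\<^sub>0"
      using nonpos_Ints_nonpos by fastforce
    then have "Gamma (real DIM('a) / 2 + 1) = real DIM('a) / 2 * Gamma (real DIM('a) / 2)"
      by (rule Gamma_plus1)
    then show ?thesis
      using Gamma_real_pos[OF pos, THEN less_imp_neq] by (simp add: unit_ball_vol_def)
  qed
  finally show ?thesis .
qed

text \<open>Completing the square: \<open>2 (v \<bullet> x) - |x|\<^sup>2 = |v|\<^sup>2 - |x - v|\<^sup>2\<close>, and Lebesgue measure is invariant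
  under the translation by \<open>v\<close>.\<close>

lemma nn_integral_exp_inner_gaussian:
  fixes v :: "'a::euclidean_space"
  shows "(\<integral>\<^sup>+x. ennreal (exp (2 * (v \<bullet> x) - (norm x)\<^sup>2)) \<partial>lborel)
           = ennreal (pi powr (DIM('a) / 2) * exp ((norm v)\<^sup>2))"
proof -
  have "(\<integral>\<^sup>+x. ennreal (exp (2 * (v \<bullet> x) - (norm x)\<^sup>2)) \<partial>lborel)
      = (\<integral>\<^sup>+x. ennreal (exp (2 * (v \<bullet> x) - (norm x)\<^sup>2)) \<partial>distr lborel borel ((+) v))"
    by (simp add: lborel_distr_plus)
  also have "\<dots> = (\<integral>\<^sup>+x. ennreal (exp (2 * (v \<bullet> (v + x)) - (norm (v + x))\<^sup>2)) \<partial>lborel)"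
    by (subst nn_integral_distr) auto
  also have "(\<lambda>x. ennreal (exp (2 * (v \<bullet> (v + x)) - (norm (v + x))\<^sup>2)))
      = (\<lambda>x. ennreal (exp ((norm v)\<^sup>2)) * ennreal (exp (- (norm x)\<^sup>2)))"
    by (auto simp: fun_eq_iff ennreal_mult'[symmetric] exp_add[symmetric]
        power2_norm_eq_inner inner_add_left inner_add_right inner_commute)
  also have "(\<integral>\<^sup>+(x::'a). ennreal (exp ((norm v)\<^sup>2)) * ennreal (exp (- (norm x)\<^sup>2)) \<partial>lborel)
      = ennreal (exp ((norm v)\<^sup>2)) * ennreal (pi powr (DIM('a) / 2))"
    by (subst nn_integral_cmult) (auto simp: nn_integral_gaussian)
  finally show ?thesis by (simp add: ennreal_mult'[symmetric] mult_ac)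
qed

text \<open>This is the generating function of the even Gaussian moments of a linear form. Averaging over
  \<open>v\<close> and \<open>- v\<close> leaves a power series with nonnegative terms, so that it can later be
  integrated term by term without any convergence argument.\<close>

lemma nn_integral_cosh_inner_gaussian:
  fixes v :: "'a::euclidean_space"
  shows "(\<integral>\<^sup>+x. ennreal (cosh (2 * (v \<bullet> x)) * exp (- (norm x)\<^sup>2)) \<partial>lborel)
           = ennreal (pi powr (DIM('a) / 2) * exp ((norm v)\<^sup>2))"
proof -
  define c where "c = pi powr (DIM('a) / 2) * exp ((norm v)\<^sup>2)"
  have "(\<lambda>x. ennreal (cosh (2 * (v \<bullet> x)) * exp (- (norm x)\<^sup>2)))
      = (\<lambda>x. ennreal (1 / 2) * (ennreal (exp (2 * (v \<bullet> x) - (norm x)\<^sup>2))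
                              + ennreal (exp (2 * ((- v) \<bullet> x) - (norm x)\<^sup>2))))"
  proof
    fix x
    have "cosh (2 * (v \<bullet> x)) * exp (- (norm x)\<^sup>2)
        = 1 / 2 * (exp (2 * (v \<bullet> x) - (norm x)\<^sup>2) + exp (2 * ((- v) \<bullet> x) - (norm x)\<^sup>2))"
      by (simp add: cosh_def exp_diff exp_minus field_simps)
    then show "ennreal (cosh (2 * (v \<bullet> x)) * exp (- (norm x)\<^sup>2))
        = ennreal (1 / 2) * (ennreal (exp (2 * (v \<bullet> x) - (norm x)\<^sup>2))
                              + ennreal (exp (2 * ((- v) \<bullet> x) - (norm x)\<^sup>2)))"
      by (simp only:) (subst ennreal_mult', auto)
  qed
  then have "(\<integral>\<^sup>+x. ennreal (cosh (2 * (v \<bullet> x)) * exp (- (norm x)\<^sup>2)) \<partial>lborel)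
      = ennreal (1 / 2) * (ennreal c + ennreal c)"
    by (simp add: nn_integral_cmult nn_integral_add nn_integral_exp_inner_gaussian[of v] c_def
        nn_integral_exp_inner_gaussian[of "-v", simplified])
  also have "\<dots> = ennreal (1 / 2 * (c + c))"
    by (subst ennreal_mult', simp, subst ennreal_plus) (auto simp: c_def)
  finally show ?thesis by (simp add: c_def)
qed

text \<open>The identity theorem for power series is about a neighbourhood of \<open>0\<close>, whereas the variable \<open>\<tau> = t\<^sup>2\<close>
  of the generating function only takes positive values. Isolation of the zeros of a nonzero power
  series is enough to conclude from one side.\<close>

lemma powser_coeffs_unique_pos:
  fixes a b :: "nat \<Rightarrow> real"
  assumes a: "\<And>x. x > 0 \<Longrightarrow> (\<lambda>n. a n * x ^ n) sums F x"
    and b: "\<And>x. x > 0 \<Longrightarrow> (\<lambda>n. b n * x ^ n) sums F x"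
  shows "a = b"
proof (rule ccontr)
  assume "a \<noteq> b"
  then obtain m where m: "a m \<noteq> b m" by auto
  \<comment> \<open>Isolation of zeros is stated for a series that vanishes at \<open>0\<close>; the product of \<open>x\<close> with the
    difference of the two series is one.\<close>
  define c where "c n = (case n of 0 \<Rightarrow> 0 | Suc i \<Rightarrow> a i - b i)" for n
  have d: "(\<lambda>n. (a n - b n) * x ^ n) sums 0" if "x > 0" for x
    using sums_diff[OF a[OF that] b[OF that]] by (simp add: algebra_simps)
  have c_sums: "(\<lambda>n. c n * x ^ n) sums (x * (\<Sum>n. (a n - b n) * x ^ n))" if "\<bar>x\<bar> < 1" for x
  proof -
    have "summable (\<lambda>n. (a n - b n) * x ^ n)"
      using d[of 1] that by (intro powser_inside[of _ 1 x]) (auto simp: sums_iff)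
    then have "(\<lambda>n. x * ((a n - b n) * x ^ n)) sums (x * (\<Sum>n. (a n - b n) * x ^ n))"
      by (intro sums_mult summable_sums)
    then show ?thesis
      using sums_Suc_iff[of "\<lambda>n. c n * x ^ n" "x * (\<Sum>n. (a n - b n) * x ^ n)"]
      by (simp add: c_def mult_ac)
  qed
  have "\<exists>s>0. \<forall>z\<in>cball 0 s - {0}. z * (\<Sum>n. (a n - b n) * z ^ n) \<noteq> 0"
  proof (rule powser_0_nonzero[of 1 0 c "\<lambda>x. x * (\<Sum>n. (a n - b n) * x ^ n)" "Suc m"])
    show "c (Suc m) \<noteq> 0" using m by (simp add: c_def)
  qed (use c_sums in auto)
  then obtain s where "s > 0" and s: "\<And>z. z \<in> cball 0 s - {0} \<Longrightarrow> z * (\<Sum>n. (a n - b n) * z ^ n) \<noteq> 0"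
    by blast
  with s[of s] d[of s] show False by (simp add: sums_iff)
qed

section \<open>The Fourier transform of the sphere\<close>

lemma sums_of_suminf_ennreal:
  fixes f :: "nat \<Rightarrow> real"
  assumes "\<And>i. f i \<ge> 0" "B \<ge> 0" "(\<Sum>i. ennreal (f i)) = ennreal B"
  shows "f sums B"
proof -
  have "summable f"
    using assms by (intro summable_suminf_not_top) auto
  moreover from this have "ennreal (suminf f) = ennreal B"
    using assms by (simp add: suminf_ennreal2)
  then have "suminf f = B"
    using assms \<open>summable f\<close> by (simp add: suminf_nonneg)
  ultimately show ?thesis by (simp add: sums_iff)
qed

lemma cosh_paired: "(\<lambda>m. x ^ (2 * m) / fact (2 * m)) sums cosh (x :: real)"
proof -
  have "(\<lambda>m. (\<lambda>n. if even n then x ^ n /\<^sub>R fact n else 0) (2 * m)) sums cosh x"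
    using cosh_converges[of x]
    by (subst sums_mono_reindex) (auto simp: strict_mono_def elim!: evenE)
  then show ?thesis by (simp add: field_simps)
qed

lemma nn_integral_sphere_inner_power_le:
  fixes k :: "'a::euclidean_space"
  shows "(\<integral>\<^sup>+n. ennreal ((k \<bullet> n) ^ (2 * m)) \<partial>sphere_measure)
           \<le> ennreal (norm k ^ (2 * m)) * emeasure sphere_measure (space (sphere_measure :: 'a measure))"
proof -
  have "(\<integral>\<^sup>+n. ennreal ((k \<bullet> n) ^ (2 * m)) \<partial>sphere_measure)
      \<le> (\<integral>\<^sup>+n. ennreal (norm k ^ (2 * m)) \<partial>(sphere_measure :: 'a measure))"
  proof (intro nn_integral_mono ennreal_leI)
    fix n :: 'a assume "n \<in> space sphere_measure"
    then have "\<bar>k \<bullet> n\<bar> \<le> norm k"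
      using Cauchy_Schwarz_ineq2[of k n] by (simp add: space_sphere_measure)
    then have "\<bar>k \<bullet> n\<bar> ^ (2 * m) \<le> norm k ^ (2 * m)"
      by (intro power_mono) auto
    then show "(k \<bullet> n) ^ (2 * m) \<le> norm k ^ (2 * m)"
      by (simp add: power_even_abs)
  qed
  then show ?thesis by simp
qed

text \<open>A linear form to the power \<open>2 m\<close> is homogeneous, so polar coordinates split its Gaussian moment
  into the moment over the sphere and a one-dimensional Gaussian moment.\<close>

lemma nn_integral_inner_power_gaussian:
  fixes k :: "'a::euclidean_space"
  shows "(\<integral>\<^sup>+x. ennreal ((k \<bullet> x) ^ (2 * m) * exp (- (norm x)\<^sup>2)) \<partial>lborel)
           = (\<integral>\<^sup>+n. ennreal ((k \<bullet> n) ^ (2 * m)) \<partial>sphere_measure)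
             * ennreal (Gamma (real m + DIM('a) / 2) / 2)"
proof -
  have fin: "(\<integral>\<^sup>+n. ennreal ((k \<bullet> n) ^ (2 * m)) \<partial>sphere_measure) < \<infinity>"
    by (rule le_less_trans[OF nn_integral_sphere_inner_power_le])
       (simp add: emeasure_sphere_measure_space ennreal_mult_less_top)
  have "ennreal ((k \<bullet> x) ^ (2 * m) * exp (- (norm x)\<^sup>2))
      = ennreal ((k \<bullet> sgn x) ^ (2 * m)) * ennreal (norm x ^ (2 * m) * exp (- (norm x)\<^sup>2))" for x
  proof -
    have "k \<bullet> x = norm x * (k \<bullet> sgn x)"
      by (cases "x = 0") (simp_all add: sgn_div_norm)
    then show ?thesis
      by (subst ennreal_mult'[symmetric]) (simp_all add: power_mult_distrib)
  qed
  then have "(\<integral>\<^sup>+x. ennreal ((k \<bullet> x) ^ (2 * m) * exp (- (norm x)\<^sup>2)) \<partial>lborel)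
      = (\<integral>\<^sup>+n. ennreal ((k \<bullet> n) ^ (2 * m)) \<partial>sphere_measure)
        * (\<integral>\<^sup>+r. ennreal (r ^ (2 * m) * exp (- r\<^sup>2)) * ennreal (r ^ (DIM('a) - 1)) * indicator {0..} r \<partial>lborel)"
    using nn_integral_polar[of "\<lambda>n. ennreal ((k \<bullet> n) ^ (2 * m))" "\<lambda>r. ennreal (r ^ (2 * m) * exp (- r\<^sup>2))"] fin
    by simp
  also have "(\<integral>\<^sup>+r. ennreal (r ^ (2 * m) * exp (- r\<^sup>2)) * ennreal (r ^ (DIM('a) - 1)) * indicator {0..} r \<partial>lborel)
      = (\<integral>\<^sup>+r. ennreal (exp (- r\<^sup>2)) * ennreal (r ^ (2 * m + DIM('a) - 1)) * indicator {0..} r \<partial>lborel)"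
    by (intro nn_integral_cong)
       (auto simp: indicator_def ennreal_mult'[symmetric] power_add[symmetric] Suc_leI ac_simps)
  also have "\<dots> = ennreal (Gamma (real m + DIM('a) / 2) / 2)"
    unfolding nn_integral_radial_gaussian_moment by (simp add: of_nat_diff Suc_leI add_divide_distrib)
  finally show ?thesis .
qed

text \<open>Expanding the generating function gives the Gaussian moments of \<open>x \<mapsto> k \<bullet> x\<close> by comparison of
  coefficients with the exponential series, and polar coordinates convert them into moments over the
  sphere. The Gamma function of the radial integral is what becomes the factor \<open>rGamma\<close> of the
  Bessel series.\<close>

lemma nn_integral_sphere_inner_power:
  fixes k :: "'a::euclidean_space"
  shows "(\<integral>\<^sup>+n. ennreal ((k \<bullet> n) ^ (2 * m)) \<partial>sphere_measure)
           = ennreal (2 * pi powr (DIM('a) / 2) * fact (2 * m) / fact m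
                        * (norm k / 2) ^ (2 * m) * rGamma (real m + DIM('a) / 2))"
proof -
  define S where "S m = enn2real (\<integral>\<^sup>+n. ennreal ((k \<bullet> n) ^ (2 * m)) \<partial>sphere_measure)" for m
  define a where "a m = S m * (Gamma (real m + DIM('a) / 2) / 2)" for m
  define c where "c = pi powr (DIM('a) / 2)"
  have Gpos: "Gamma (real m + DIM('a) / 2) > 0" for m
    by (intro Gamma_real_pos add_nonneg_pos) auto
  have S: "(\<integral>\<^sup>+n. ennreal ((k \<bullet> n) ^ (2 * m)) \<partial>sphere_measure) = ennreal (S m)" for m
  proof -
    have "(\<integral>\<^sup>+n. ennreal ((k \<bullet> n) ^ (2 * m)) \<partial>sphere_measure) < top"
      by (rule le_less_trans[OF nn_integral_sphere_inner_power_le])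
         (simp add: emeasure_sphere_measure_space ennreal_mult_less_top)
    then show ?thesis by (simp add: S_def)
  qed
  have S_nonneg: "S m \<ge> 0" for m by (simp add: S_def)
  have a_nonneg: "a m \<ge> 0" for m
    using S_nonneg[of m] Gpos[of m] by (simp add: a_def)
  have a: "(\<integral>\<^sup>+x. ennreal ((k \<bullet> x) ^ (2 * m) * exp (- (norm x)\<^sup>2)) \<partial>lborel) = ennreal (a m)" for m
    unfolding nn_integral_inner_power_gaussian S a_def
    using S_nonneg[of m] by (simp only: ennreal_mult'[symmetric])
  have eq: "(\<lambda>m. 4 ^ m / fact (2 * m) * a m) = (\<lambda>m. c * (norm k) ^ (2 * m) / fact m)"
  proof (rule powser_coeffs_unique_pos)
    fix \<tau> :: real assume \<tau>: "\<tau> > 0"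
    \<comment> \<open>The generating function is even in \<open>t\<close>, hence a power series in \<open>\<tau> = t\<^sup>2\<close>.\<close>
    define t where "t = sqrt \<tau>"
    have t2: "t\<^sup>2 = \<tau>" using \<tau> by (simp add: t_def)
    have p: "(2 * t) ^ (2 * m) = 4 ^ m * \<tau> ^ m" for m
      by (simp add: power_mult power_mult_distrib t2)
    have "ennreal (c * exp ((norm (t *\<^sub>R k))\<^sup>2))
        = (\<integral>\<^sup>+x. ennreal (cosh (2 * ((t *\<^sub>R k) \<bullet> x)) * exp (- (norm x)\<^sup>2)) \<partial>lborel)"
      unfolding c_def by (rule nn_integral_cosh_inner_gaussian[symmetric])
    also have "\<dots> = (\<integral>\<^sup>+x. (\<Sum>m. ennreal ((2 * t) ^ (2 * m) / fact (2 * m))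
                              * ennreal ((k \<bullet> x) ^ (2 * m) * exp (- (norm x)\<^sup>2))) \<partial>lborel)"
    proof (rule nn_integral_cong)
      fix x :: 'a
      let ?f = "\<lambda>m. (2 * t) ^ (2 * m) / fact (2 * m) * ((k \<bullet> x) ^ (2 * m) * exp (- (norm x)\<^sup>2))"
      have "(\<lambda>m. (2 * ((t *\<^sub>R k) \<bullet> x)) ^ (2 * m) / fact (2 * m) * exp (- (norm x)\<^sup>2)) sums
          (cosh (2 * ((t *\<^sub>R k) \<bullet> x)) * exp (- (norm x)\<^sup>2))"
        by (intro sums_mult2 cosh_paired)
      then have "?f sums (cosh (2 * ((t *\<^sub>R k) \<bullet> x)) * exp (- (norm x)\<^sup>2))"
        by (simp add: power_mult_distrib mult_ac)
      then have "(\<Sum>m. ennreal (?f m)) = ennreal (cosh (2 * ((t *\<^sub>R k) \<bullet> x)) * exp (- (norm x)\<^sup>2))"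
        by (subst suminf_ennreal2) (auto simp: sums_iff)
      then show "ennreal (cosh (2 * ((t *\<^sub>R k) \<bullet> x)) * exp (- (norm x)\<^sup>2))
          = (\<Sum>m. ennreal ((2 * t) ^ (2 * m) / fact (2 * m))
                  * ennreal ((k \<bullet> x) ^ (2 * m) * exp (- (norm x)\<^sup>2)))"
        by (subst ennreal_mult'[symmetric]) auto
    qed
    also have "\<dots> = (\<Sum>m. ennreal ((2 * t) ^ (2 * m) / fact (2 * m)) * ennreal (a m))"
      by (subst nn_integral_suminf) (auto simp: nn_integral_cmult a)
    also have "\<dots> = (\<Sum>m. ennreal (4 ^ m / fact (2 * m) * a m * \<tau> ^ m))"
    proof -
      have "ennreal ((2 * t) ^ (2 * m) / fact (2 * m)) * ennreal (a m)
          = ennreal (4 ^ m / fact (2 * m) * a m * \<tau> ^ m)" for m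
        unfolding p using \<tau> by (subst ennreal_mult'[symmetric]) (simp_all add: mult_ac)
      then show ?thesis by simp
    qed
    finally show "(\<lambda>m. 4 ^ m / fact (2 * m) * a m * \<tau> ^ m) sums (c * exp (\<tau> * (norm k)\<^sup>2))"
      using a_nonneg \<tau>
      by (intro sums_of_suminf_ennreal) (auto simp: c_def power_mult_distrib t2)
    have "(\<lambda>m. c * ((\<tau> * (norm k)\<^sup>2) ^ m /\<^sub>R fact m)) sums (c * exp (\<tau> * (norm k)\<^sup>2))"
      by (intro sums_mult exp_converges)
    moreover have "c * ((\<tau> * (norm k)\<^sup>2) ^ m /\<^sub>R fact m) = c * (norm k) ^ (2 * m) / fact m * \<tau> ^ m" for m
      unfolding power_mult power_mult_distrib by (simp add: field_simps)
    ultimately show "(\<lambda>m. c * (norm k) ^ (2 * m) / fact m * \<tau> ^ m) sums (c * exp (\<tau> * (norm k)\<^sup>2))"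
      by simp
  qed
  have "S m = 2 * c * fact (2 * m) / fact m * (norm k / 2) ^ (2 * m) * rGamma (real m + DIM('a) / 2)"
  proof -
    have "4 ^ m / fact (2 * m) * (S m * (Gamma (real m + DIM('a) / 2) / 2)) = c * (norm k) ^ (2 * m) / fact m"
      using fun_cong[OF eq, of m] by (simp add: a_def)
    moreover have "norm k ^ (2 * m) = (norm k / 2) ^ (2 * m) * 4 ^ m"
      by (simp add: power_divide power_mult)
    moreover have "s = 2 * c * F / F' * B * inverse G"
      if "P / F * (s * (G / 2)) = c * K / F'" "K = B * P" "P > 0" "F > 0" "F' > 0" "G > 0"
      for s B F F' G K P :: real
    proof -
      have "P * (s * G * F') = P * (2 * c * F * B)"
        using that by (simp add: field_simps)
      then show ?thesis
        using that(3-) by (simp add: field_simps)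
    qed
    ultimately show ?thesis
      using Gpos[of m] unfolding rGamma_inverse_Gamma by simp
  qed
  then show ?thesis by (simp add: S c_def)
qed

lemma integrable_sphere_measure:
  fixes g :: "'a::euclidean_space \<Rightarrow> 'b::{banach, second_countable_topology}"
  assumes "g \<in> borel_measurable borel" "\<And>n. norm n = 1 \<Longrightarrow> norm (g n) \<le> B"
  shows "integrable sphere_measure g"
proof -
  interpret finite_measure "sphere_measure :: 'a measure" by (rule finite_measure_sphere_measure)
  show ?thesis
    using assms by (intro integrable_const_bound[of _ B]) (auto simp: space_sphere_measure)
qed

lemma sphere_integral_odd:
  fixes g :: "'a::euclidean_space \<Rightarrow> real"
  assumes [measurable]: "g \<in> borel_measurable borel" and "\<And>n. g (- n) = - g n"
  shows "(LINT n|sphere_measure. g n) = 0"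
proof -
  have "(LINT n|sphere_measure. g n) = (LINT n|distr sphere_measure sphere_measure uminus. g n)"
    by (simp add: sphere_measure_uminus)
  also have "\<dots> = (LINT n|sphere_measure. g (- n))"
    by (intro integral_distr measurable_uminus_sphere_measure) measurable
  finally show ?thesis by (simp add: assms)
qed

text \<open>The cosine series is integrated term by term over the sphere; this is allowed since \<open>|k \<bullet> n| \<le> |k|\<close>
  there, so that the series is dominated by that of \<open>cosh |k|\<close>.\<close>

lemma sphere_integral_cos_inner:
  fixes k :: "'a::euclidean_space"
  shows "(\<lambda>m. 2 * pi powr (DIM('a) / 2) * ((-1) ^ m / fact m * rGamma (real m + DIM('a) / 2) * (norm k / 2) ^ (2 * m)))
           sums (LINT n|sphere_measure. cos (k \<bullet> n))"
proof -
  interpret finite_measure "sphere_measure :: 'a measure" by (rule finite_measure_sphere_measure)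
  define f where "f m n = (-1) ^ m / fact (2 * m) * (k \<bullet> n) ^ (2 * m)" for m n
  define S where "S m = 2 * pi powr (DIM('a) / 2) * fact (2 * m) / fact m
                        * (norm k / 2) ^ (2 * m) * rGamma (real m + DIM('a) / 2)" for m
  have "rGamma (real m + DIM('a) / 2) > 0" for m
    by (auto simp: rGamma_inverse_Gamma intro!: Gamma_real_pos add_nonneg_pos)
  then have S_nonneg: "S m \<ge> 0" for m
    by (simp add: S_def less_imp_le)
  have le: "(k \<bullet> n) ^ (2 * m) \<le> norm k ^ (2 * m)" if "norm n = 1" for n m
  proof -
    have "\<bar>k \<bullet> n\<bar> ^ (2 * m) \<le> norm k ^ (2 * m)"
      using Cauchy_Schwarz_ineq2[of k n] that by (intro power_mono) auto
    then show ?thesis by (simp add: power_even_abs)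
  qed
  have int: "integrable sphere_measure (\<lambda>n. (k \<bullet> n) ^ (2 * m))" for m
    using le by (intro integrable_sphere_measure[of _ "norm k ^ (2 * m)"]) auto
  have S: "(LINT n|sphere_measure. (k \<bullet> n) ^ (2 * m)) = S m" for m
    using nn_integral_sphere_inner_power[of k m] S_nonneg[of m]
    by (subst integral_eq_nn_integral) (auto simp: S_def)
  have "(\<lambda>m. LINT n|sphere_measure. f m n) sums (LINT n|sphere_measure. (\<Sum>m. f m n))"
  proof (rule sums_integral)
    show "integrable sphere_measure (f m)" for m
      unfolding f_def by (intro integrable_mult_right int)
    show "AE n in sphere_measure. summable (\<lambda>m. norm (f m n))"
    proof (rule AE_I2)
      fix n :: 'a
      have "summable (\<lambda>m. \<bar>k \<bullet> n\<bar> ^ (2 * m) / fact (2 * m))"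
        using cosh_paired[of "\<bar>k \<bullet> n\<bar>"] by (auto simp: sums_iff)
      then show "summable (\<lambda>m. norm (f m n))"
        by (simp add: f_def abs_mult power_abs)
    qed
    have "norm (f m n) = (k \<bullet> n) ^ (2 * m) / fact (2 * m)" for m n
      by (simp add: f_def abs_mult power_abs power_even_abs)
    then have *: "(LINT n|sphere_measure. norm (f m n)) = S m / fact (2 * m)" for m
      by (simp add: S)
    have "S m \<le> norm k ^ (2 * m) * measure sphere_measure (space (sphere_measure :: 'a measure))" for m
    proof -
      have "S m \<le> (LINT n|(sphere_measure :: 'a measure). norm k ^ (2 * m))"
        unfolding S[symmetric] using le by (intro integral_mono int) (auto simp: space_sphere_measure)
      then show ?thesis by (simp add: mult_ac)
    qed
    then have bound: "S m / fact (2 * m)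
        \<le> norm k ^ (2 * m) / fact (2 * m) * measure sphere_measure (space (sphere_measure :: 'a measure))" for m
      by (simp add: divide_right_mono)
    have "summable (\<lambda>m. norm k ^ (2 * m) / fact (2 * m) * measure sphere_measure (space (sphere_measure :: 'a measure)))"
      using cosh_paired[of "norm k"] by (intro summable_mult2) (auto simp: sums_iff)
    then have "summable (\<lambda>m. S m / fact (2 * m))"
      by (rule summable_comparison_test'[of _ 0]) (simp only: real_norm_def abs_of_nonneg S_nonneg
          divide_nonneg_nonneg fact_ge_zero bound)
    then show "summable (\<lambda>m. LINT n|sphere_measure. norm (f m n))"
      by (simp only: *)
  qed
  moreover have "(\<Sum>m. f m n) = cos (k \<bullet> n)" for n
    using cos_paired[of "k \<bullet> n"] by (simp add: f_def sums_iff)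
  moreover have "(LINT n|sphere_measure. f m n) = 2 * pi powr (DIM('a) / 2)
      * ((-1) ^ m / fact m * rGamma (real m + DIM('a) / 2) * (norm k / 2) ^ (2 * m))" for m
    unfolding f_def by (simp add: S) (simp add: S_def)
  ultimately show ?thesis by simp
qed

text \<open>The imaginary part vanishes because the sine is odd. For \<open>N = DIM('a)\<close> and \<open>\<nu> = N / 2 - 1\<close>, the
  series of the real part is the one of \<open>J\<^sub>\<nu>(|k|)\<close>, up to a constant and the power
  \<open>(|k| / 2)\<^sup>\<nu>\<close> in front of the latter.\<close>

lemma sphere_fourier:
  fixes k :: "'a::euclidean_space"
  assumes "k \<noteq> 0"
  defines "\<nu> \<equiv> DIM('a) / 2 - 1"
  shows "(LINT n|sphere_measure. exp (\<i> * complex_of_real (k \<bullet> n)))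
           = complex_of_real ((2 * pi) powr (DIM('a) / 2) * norm k powr (- \<nu>) * bessel_J \<nu> (norm k))"
proof -
  define z where "z = norm k"
  have z: "z > 0" using assms by (simp add: z_def)
  define C where "C = (LINT n|sphere_measure. cos (k \<bullet> n))"
  have int: "integrable sphere_measure (\<lambda>n. complex_of_real (cos (k \<bullet> n)))"
    "integrable sphere_measure (\<lambda>n. complex_of_real (sin (k \<bullet> n)))"
    by (rule integrable_sphere_measure[of _ 1]; simp)+
  have "(LINT n|sphere_measure. exp (\<i> * complex_of_real (k \<bullet> n)))
      = (LINT n|sphere_measure. complex_of_real (cos (k \<bullet> n)) + \<i> * complex_of_real (sin (k \<bullet> n)))"
    by (intro Bochner_Integration.integral_cong refl)
       (simp add: cis_conv_exp[symmetric] complex_eq_iff)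
  also have "\<dots> = complex_of_real C + \<i> * complex_of_real (LINT n|sphere_measure. sin (k \<bullet> n))"
    using int by (simp add: C_def)
  also have "(LINT n|sphere_measure. sin (k \<bullet> n)) = 0"
    by (intro sphere_integral_odd) auto
  finally have 1: "(LINT n|sphere_measure. exp (\<i> * complex_of_real (k \<bullet> n))) = complex_of_real C" by simp
  have "(\<lambda>m. (z / 2) powr \<nu> / (2 * pi powr (DIM('a) / 2))
            * (2 * pi powr (DIM('a) / 2) * ((-1) ^ m / fact m * rGamma (real m + DIM('a) / 2) * (z / 2) ^ (2 * m))))
      sums ((z / 2) powr \<nu> / (2 * pi powr (DIM('a) / 2)) * C)"
    unfolding z_def C_def by (intro sums_mult sphere_integral_cos_inner)
  also have "(\<lambda>m. (z / 2) powr \<nu> / (2 * pi powr (DIM('a) / 2))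
            * (2 * pi powr (DIM('a) / 2) * ((-1) ^ m / fact m * rGamma (real m + DIM('a) / 2) * (z / 2) ^ (2 * m))))
      = (\<lambda>m. (-1) ^ m / fact m * rGamma (real m + \<nu> + 1) * (z / 2) powr (2 * real m + \<nu>))"
  proof
    fix m
    have "(z / 2) powr (2 * real m + \<nu>) = (z / 2) powr real (2 * m) * (z / 2) powr \<nu>"
      by (simp add: powr_add)
    also have "(z / 2) powr real (2 * m) = (z / 2) ^ (2 * m)"
      using z by (intro powr_realpow) simp
    finally show "(z / 2) powr \<nu> / (2 * pi powr (DIM('a) / 2))
            * (2 * pi powr (DIM('a) / 2) * ((-1) ^ m / fact m * rGamma (real m + DIM('a) / 2) * (z / 2) ^ (2 * m)))
        = (-1) ^ m / fact m * rGamma (real m + \<nu> + 1) * (z / 2) powr (2 * real m + \<nu>)"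
      by (simp add: \<nu>_def)
  qed
  finally have "bessel_J \<nu> z = (z / 2) powr \<nu> / (2 * pi powr (DIM('a) / 2)) * C"
    unfolding bessel_J_def by (simp add: sums_iff)
  then have "C = 2 * pi powr (DIM('a) / 2) / (z / 2) powr \<nu> * bessel_J \<nu> z"
    using z by (simp add: field_simps)
  also have "2 * pi powr (DIM('a) / 2) / (z / 2) powr \<nu> = (2 * pi) powr (DIM('a) / 2) * z powr (- \<nu>)"
  proof -
    have "(2::real) * 2 powr \<nu> = 2 powr (1 + \<nu>)" by (simp add: powr_add)
    then have "(2::real) * 2 powr \<nu> = 2 powr (DIM('a) / 2)" by (simp add: \<nu>_def)
    then show ?thesis
      using z by (simp add: powr_divide powr_mult powr_minus field_simps)
  qed
  finally show ?thesis unfolding 1 z_def by simp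
qed

section \<open>The Fourier transform of the conical Radon transform\<close>

lemma test_functions_continuous:
  "f \<in> test_functions U \<Longrightarrow> continuous_on UNIV f"
  unfolding test_functions_def smooth_def using C_diff.simps(1) by blast

lemma test_function_half_space_bounds:
  fixes f :: "'a::euclidean_space \<times> real \<Rightarrow> real"
  assumes f: "f \<in> test_functions (UNIV \<times> {0<..})"
  obtains a b R B where "0 < a" "\<And>x y. f (x, y) \<noteq> 0 \<Longrightarrow> norm x \<le> R \<and> a \<le> y \<and> y \<le> b"
    "\<And>z. \<bar>f z\<bar> \<le> B"
proof -
  define K where "K = closure {z. f z \<noteq> 0}"
  have K: "compact K" "K \<subseteq> UNIV \<times> {0<..}"
    using f by (auto simp: test_functions_def K_def)
  have supp: "z \<in> K" if "f z \<noteq> 0" for z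
    using that closure_subset[of "{z. f z \<noteq> 0}"] by (auto simp: K_def)
  have "bounded (f ` K)"
    using test_functions_continuous[OF f] K
    by (intro compact_imp_bounded compact_continuous_image) (auto intro: continuous_on_subset)
  then obtain B where B: "\<And>z. z \<in> K \<Longrightarrow> \<bar>f z\<bar> \<le> B" "B > 0"
    by (auto simp: bounded_pos)
  have "bounded (fst ` K)"
    using K by (intro compact_imp_bounded compact_continuous_image) (auto intro!: continuous_intros)
  then obtain R where R: "\<And>z. z \<in> K \<Longrightarrow> norm (fst z) \<le> R"
    by (auto simp: bounded_iff)
  have cs: "compact (snd ` K)"
    using K by (intro compact_continuous_image) (auto intro!: continuous_intros)
  obtain a where a: "a > 0" "\<And>z. z \<in> K \<Longrightarrow> a \<le> snd z"
  proof (cases "K = {}")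
    case False
    then obtain m where "m \<in> snd ` K" "\<And>t. t \<in> snd ` K \<Longrightarrow> m \<le> t"
      using compact_attains_inf[OF cs] by auto
    then show ?thesis using K(2) by (intro that[of m]) auto
  qed (auto intro: that[of 1])
  obtain b where b: "\<And>z. z \<in> K \<Longrightarrow> snd z \<le> b"
    using compact_imp_bounded[OF cs] by (force simp: bounded_iff abs_le_iff)
  show ?thesis
  proof (rule that[OF a(1)])
    show "norm x \<le> R \<and> a \<le> y \<and> y \<le> b" if "f (x, y) \<noteq> 0" for x y
      using R[OF supp[OF that]] a(2)[OF supp[OF that]] b[OF supp[OF that]] by simp
    show "\<bar>f z\<bar> \<le> B" for z
      using B supp[of z] by (cases "f z = 0") auto
  qed
qed

lemma fourier_translate:
  fixes h :: "'a::euclidean_space \<Rightarrow> real"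
  assumes [measurable]: "h \<in> borel_measurable borel"
  shows "(LINT u|lborel. exp (- \<i> * complex_of_real (k \<bullet> u)) * complex_of_real (h (u + v)))
           = exp (\<i> * complex_of_real (k \<bullet> v))
             * (LINT u|lborel. exp (- \<i> * complex_of_real (k \<bullet> u)) * complex_of_real (h u))"
proof -
  have "(LINT u|lborel. exp (- \<i> * complex_of_real (k \<bullet> u)) * complex_of_real (h u))
      = (LINT u|distr lborel borel ((+) v). exp (- \<i> * complex_of_real (k \<bullet> u)) * complex_of_real (h u))"
    by (simp add: lborel_distr_plus)
  also have "\<dots> = (LINT u|lborel. exp (- \<i> * complex_of_real (k \<bullet> (v + u))) * complex_of_real (h (v + u)))"
    by (rule integral_distr) auto
  also have "\<dots> = (LINT u|lborel. exp (- \<i> * complex_of_real (k \<bullet> v))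
        * (exp (- \<i> * complex_of_real (k \<bullet> u)) * complex_of_real (h (u + v))))"
    by (simp add: inner_add_right distrib_left exp_add[symmetric] mult.assoc[symmetric] add.commute
        flip: exp_add)
  also have "\<dots> = exp (- \<i> * complex_of_real (k \<bullet> v))
        * (LINT u|lborel. exp (- \<i> * complex_of_real (k \<bullet> u)) * complex_of_real (h (u + v)))"
    by simp
  finally show ?thesis
    by (simp add: mult.assoc[symmetric] flip: exp_add)
qed

text \<open>For fixed \<open>s\<close> and \<open>n\<close> the integral over \<open>u\<close> is the Fourier transform of a translate of \<open>f\<close>, so it
  contributes only the phase \<open>exp (i k \<bullet> (s sin \<theta>) n)\<close> and the Fourier transform of \<open>f\<close> at height
  \<open>s cos \<theta>\<close>. Pulling the integral over \<open>u\<close> inside is justified by the support of \<open>f\<close>: it is compact and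
  stays away from height \<open>0\<close>, so the integrand is bounded, and only \<open>s\<close> in a compact subinterval
  \<open>[s0, s1]\<close> of the open half line and \<open>u\<close> in a ball matter, whatever the sign of \<open>p\<close>.\<close>

lemma fourier_conical_radon:
  fixes f :: "'a::euclidean_space \<times> real \<Rightarrow> real" and k :: 'a
  assumes f: "f \<in> test_functions (UNIV \<times> {0<..})" and \<theta>: "0 < \<theta>" "\<theta> < pi / 2"
  shows "fourier1 (\<lambda>z. complex_of_real (conical_radon p f z)) (k, \<theta>)
    = (LBINT s:{0<..}. complex_of_real (s powr (- p) * (s * sin \<theta>) ^ (DIM('a) - 1))
         * fourier1 (\<lambda>z. complex_of_real (f z)) (k, s * cos \<theta>)
         * (LINT n|sphere_measure. exp (\<i> * complex_of_real (k \<bullet> ((s * sin \<theta>) *\<^sub>R n)))))"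
proof -
  let ?S = "sphere_measure :: 'a measure"
  interpret S: finite_measure ?S by (rule finite_measure_sphere_measure)
  interpret LS: pair_sigma_finite "lborel :: 'a measure" ?S ..
  obtain a b R B where a: "0 < a"
    and supp: "\<And>x y. f (x, y) \<noteq> 0 \<Longrightarrow> norm x \<le> R \<and> a \<le> y \<and> y \<le> b"
    and B: "\<And>z. \<bar>f z\<bar> \<le> B"
    using test_function_half_space_bounds[OF f] by metis
  have B0: "B \<ge> 0" using B[of undefined] by simp
  have [measurable]: "f \<in> borel_measurable borel"
    by (intro borel_measurable_continuous_onI test_functions_continuous[OF f])
  have [measurable]: "(\<lambda>n. n) \<in> measurable ?S borel"
    by (rule measurable_sphere_measure) simp
  have c: "cos \<theta> > 0" using \<theta> by (intro cos_gt_zero) auto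
  define s0 s1 where "s0 = a / cos \<theta>" and "s1 = b / cos \<theta>"
  have s0: "s0 > 0" using a c by (simp add: s0_def)
  define w where "w s = s powr (- p) * (s * sin \<theta>) ^ (DIM('a) - 1)" for s
  define g where "g u s n = exp (- \<i> * complex_of_real (k \<bullet> u))
      * complex_of_real (indicator {0<..} s * w s * f (u + (s * sin \<theta>) *\<^sub>R n, s * cos \<theta>))" for u s n
  have w_meas [measurable]: "w \<in> borel_measurable borel"
    unfolding w_def by measurable
  have "bounded (w ` {s0..s1})"
    using s0 unfolding w_def
    by (intro compact_imp_bounded compact_continuous_image) (auto intro!: continuous_intros)
  then obtain W where W: "\<And>s. s \<in> {s0..s1} \<Longrightarrow> \<bar>w s\<bar> \<le> W"
    unfolding bounded_iff by (metis imageI real_norm_def)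
  \<comment> \<open>On the support of \<open>f\<close> the horizontal displacement is at most \<open>s \<le> s1\<close>, which bounds \<open>u\<close>.\<close>
  have g_supp: "norm u \<le> R + s1 \<and> s \<in> {s0..s1}" if "g u s n \<noteq> 0" "norm n = 1" for u s n
  proof -
    have ne: "f (u + (s * sin \<theta>) *\<^sub>R n, s * cos \<theta>) \<noteq> 0" and s: "s > 0"
      using that(1) by (auto simp: g_def indicator_def split: if_splits)
    have *: "norm (u + (s * sin \<theta>) *\<^sub>R n) \<le> R" "a \<le> s * cos \<theta>" "s * cos \<theta> \<le> b"
      using supp[OF ne] by auto
    have s': "s \<in> {s0..s1}"
      using * c by (simp add: s0_def s1_def field_simps)
    have "norm u \<le> norm (u + (s * sin \<theta>) *\<^sub>R n) + norm ((s * sin \<theta>) *\<^sub>R n)"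
      using norm_triangle_ineq4[of "u + (s * sin \<theta>) *\<^sub>R n" "(s * sin \<theta>) *\<^sub>R n"] by simp
    also have "norm ((s * sin \<theta>) *\<^sub>R n) \<le> s"
      using s that(2) by (simp add: abs_mult mult_left_le)
    finally show ?thesis using * s' by auto
  qed
  have g_bound: "norm (g u s n) \<le> \<bar>W\<bar> * B" if "norm n = 1" for u s n
  proof (cases "g u s n = 0")
    case False
    then have "\<bar>w s\<bar> \<le> \<bar>W\<bar>" using g_supp[OF False that] W[of s] by auto
    then have "\<bar>w s\<bar> * \<bar>f (u + (s * sin \<theta>) *\<^sub>R n, s * cos \<theta>)\<bar> \<le> \<bar>W\<bar> * B"
      by (intro mult_mono B) auto
    then show ?thesis
      using B0 by (auto simp: g_def norm_mult abs_mult indicator_def)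
  qed (use B0 in auto)
  define H where "H u s = (LINT n|?S. g u s n)" for u s
  have H_meas: "case_prod H \<in> borel_measurable (lborel \<Otimes>\<^sub>M lborel)"
    unfolding H_def g_def split_beta by measurable
  have H_supp: "norm u \<le> R + s1 \<and> s \<in> {s0..s1}" if "H u s \<noteq> 0" for u s
  proof (rule ccontr)
    assume "\<not> (norm u \<le> R + s1 \<and> s \<in> {s0..s1})"
    then have "g u s n = 0" if "norm n = 1" for n using g_supp[of u s n] that by auto
    then have "H u s = (LINT n|?S. 0)"
      unfolding H_def by (intro Bochner_Integration.integral_cong) (auto simp: space_sphere_measure)
    then show False using that by simp
  qed
  have H_bound: "norm (H u s) \<le> \<bar>W\<bar> * B * measure ?S (space ?S)" for u s
  proof -
    have "(\<lambda>n. g u s n) \<in> borel_measurable borel" unfolding g_def by measurable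
    then have int: "integrable ?S (g u s)"
      using g_bound by (intro integrable_sphere_measure[of _ "\<bar>W\<bar> * B"]) auto
    have "norm (H u s) \<le> (LINT n|?S. norm (g u s n))"
      unfolding H_def by (rule integral_norm_bound)
    also have "\<dots> \<le> (LINT n|?S. \<bar>W\<bar> * B)"
      using int g_bound by (intro integral_mono) (auto simp: space_sphere_measure)
    finally show ?thesis by (simp add: mult_ac)
  qed
  have H_int: "integrable (lborel \<Otimes>\<^sub>M lborel) (case_prod H)"
  proof (rule integrableI_bounded_set[where A = "cball 0 (R + s1) \<times> {s0..s1}" and B = "\<bar>W\<bar> * B * measure ?S (space ?S)"])
    show "emeasure (lborel \<Otimes>\<^sub>M lborel) (cball (0::'a) (R + s1) \<times> {s0..s1}) < \<infinity>"
      unfolding lborel_prod by (intro emeasure_bounded_finite bounded_Times) auto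
    show "AE x in lborel \<Otimes>\<^sub>M lborel. x \<in> cball (0::'a) (R + s1) \<times> {s0..s1} \<longrightarrow>
        norm (case_prod H x) \<le> \<bar>W\<bar> * B * measure ?S (space ?S)"
      using H_bound by auto
    show "AE x in lborel \<Otimes>\<^sub>M lborel. x \<notin> cball (0::'a) (R + s1) \<times> {s0..s1} \<longrightarrow> case_prod H x = 0"
      using H_supp by (intro AE_I2) force
  qed (use H_meas in auto)
  have g_int: "integrable (lborel \<Otimes>\<^sub>M ?S) (\<lambda>(u, n). g u s n)" for s
  proof (rule integrableI_bounded_set[where A = "cball 0 (R + s1) \<times> space ?S" and B = "\<bar>W\<bar> * B"])
    show "emeasure (lborel \<Otimes>\<^sub>M ?S) (cball (0::'a) (R + s1) \<times> space ?S) < \<infinity>"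
      using emeasure_bounded_finite[OF bounded_cball, of "0::'a" "R + s1"]
      by (subst S.emeasure_pair_measure_Times)
        (simp_all add: ennreal_mult_less_top emeasure_sphere_measure_space)
    show "AE x in lborel \<Otimes>\<^sub>M ?S. x \<in> cball (0::'a) (R + s1) \<times> space ?S \<longrightarrow>
        norm (case x of (u, n) \<Rightarrow> g u s n) \<le> \<bar>W\<bar> * B"
      using g_bound by (auto simp: space_sphere_measure)
    show "AE x in lborel \<Otimes>\<^sub>M ?S. x \<notin> cball (0::'a) (R + s1) \<times> space ?S \<longrightarrow>
        (case x of (u, n) \<Rightarrow> g u s n) = 0"
      using g_supp by (intro AE_I2) (force simp: space_pair_measure space_sphere_measure)
    show "(\<lambda>(u, n). g u s n) \<in> borel_measurable (lborel \<Otimes>\<^sub>M ?S)"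
      unfolding g_def split_beta by measurable
  qed auto
  \<comment> \<open>The interchange takes two steps: first \<open>u\<close> with \<open>s\<close>, then, for fixed \<open>s\<close>, \<open>u\<close> with \<open>n\<close>.\<close>
  have "fourier1 (\<lambda>z. complex_of_real (conical_radon p f z)) (k, \<theta>)
      = (LINT u|lborel. LINT s|lborel. H u s)"
    unfolding fourier1_def conical_radon_def set_lebesgue_integral_def H_def g_def w_def prod.case
    by (simp add: powr_minus_divide mult_ac
        flip: integral_mult_right_zero integral_complex_of_real integral_mult_left_zero)
  also have "\<dots> = (LINT s|lborel. LINT u|lborel. H u s)"
    by (rule lborel_pair.Fubini_integral[OF H_int, symmetric])
  also have "\<dots> = (LINT s|lborel. LINT n|?S. LINT u|lborel. g u s n)"
    unfolding H_def by (intro Bochner_Integration.integral_cong refl LS.Fubini_integral[OF g_int, symmetric])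
  also have "\<dots> = (LINT s|lborel. indicator {0<..} s *\<^sub>R
      (complex_of_real (w s) * fourier1 (\<lambda>z. complex_of_real (f z)) (k, s * cos \<theta>)
         * (LINT n|?S. exp (\<i> * complex_of_real (k \<bullet> ((s * sin \<theta>) *\<^sub>R n))))))"
  proof (intro Bochner_Integration.integral_cong refl)
    fix s
    have "(LINT u|lborel. g u s n) = indicator {0<..} s *\<^sub>R (complex_of_real (w s)
        * (exp (\<i> * complex_of_real (k \<bullet> ((s * sin \<theta>) *\<^sub>R n))) * fourier1 (\<lambda>z. complex_of_real (f z)) (k, s * cos \<theta>)))" for n
    proof -
      have "(LINT u|lborel. g u s n) = (LINT u|lborel. complex_of_real (indicator {0<..} s * w s)
          * (exp (- \<i> * complex_of_real (k \<bullet> u)) * complex_of_real (f (u + (s * sin \<theta>) *\<^sub>R n, s * cos \<theta>))))"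
        unfolding g_def by (simp add: mult_ac)
      also have "\<dots> = complex_of_real (indicator {0<..} s * w s)
          * (exp (\<i> * complex_of_real (k \<bullet> ((s * sin \<theta>) *\<^sub>R n))) * fourier1 (\<lambda>z. complex_of_real (f z)) (k, s * cos \<theta>))"
        unfolding integral_mult_right_zero fourier1_def prod.case
        by (subst fourier_translate[where h = "\<lambda>x. f (x, s * cos \<theta>)"]) auto
      finally show ?thesis by (simp add: scaleR_conv_of_real mult_ac)
    qed
    then show "(LINT n|?S. LINT u|lborel. g u s n) = indicator {0<..} s *\<^sub>R
      (complex_of_real (w s) * fourier1 (\<lambda>z. complex_of_real (f z)) (k, s * cos \<theta>)
         * (LINT n|?S. exp (\<i> * complex_of_real (k \<bullet> ((s * sin \<theta>) *\<^sub>R n)))))"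
      by (simp add: mult_ac)
  qed
  finally show ?thesis
    unfolding set_lebesgue_integral_def w_def .
qed

text \<open>The inner integral over the sphere is now a Bessel function of \<open>s sin \<theta> |k|\<close>, and the substitution
  \<open>y = s cos \<theta>\<close>, for which \<open>s sin \<theta> = y tan \<theta>\<close>, makes it one of \<open>y |k| tan \<theta>\<close>. What remains is to
  collect powers of \<open>y\<close>, \<open>tan \<theta>\<close>, \<open>cos \<theta>\<close> and \<open>|k|\<close>, with \<open>N - 1 = 2 \<nu> + 1\<close>.\<close>

lemma fourier_conical_radon_bessel:
  fixes f :: "'a::euclidean_space \<times> real \<Rightarrow> real" and k :: 'a
  assumes f: "f \<in> test_functions (UNIV \<times> {0<..})" and \<theta>: "0 < \<theta>" "\<theta> < pi / 2" and k: "k \<noteq> 0"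
  defines "\<nu> \<equiv> DIM('a) / 2 - 1"
  shows "fourier1 (\<lambda>z. complex_of_real (conical_radon p f z)) (k, \<theta>)
    = complex_of_real ((2 * pi) powr (DIM('a) / 2) * tan \<theta> powr (DIM('a) / 2)
                         / cos \<theta> powr (1 - p) / norm k powr \<nu>)
      * (LBINT y:{0<..}. complex_of_real (y powr (\<nu> + 1 - p) * bessel_J \<nu> (y * (norm k * tan \<theta>)))
           * fourier1 (\<lambda>z. complex_of_real (f z)) (k, y))"
proof -
  have c: "cos \<theta> > 0" using \<theta> by (intro cos_gt_zero) auto
  have t: "tan \<theta> > 0" using \<theta> by (intro tan_gt_zero) auto
  have K: "norm k > 0" using k by simp
  define C where "C = (2 * pi) powr (DIM('a) / 2) * tan \<theta> powr (DIM('a) / 2)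
                         / cos \<theta> powr (1 - p) / norm k powr \<nu>"
  define G where "G s = complex_of_real (s powr (- p) * (s * sin \<theta>) ^ (DIM('a) - 1))
         * fourier1 (\<lambda>z. complex_of_real (f z)) (k, s * cos \<theta>)
         * (LINT n|sphere_measure. exp (\<i> * complex_of_real (k \<bullet> ((s * sin \<theta>) *\<^sub>R n))))" for s
  have "fourier1 (\<lambda>z. complex_of_real (conical_radon p f z)) (k, \<theta>)
      = (LINT s|lborel. indicator {0<..} s *\<^sub>R G s)"
    unfolding fourier_conical_radon[OF f \<theta>] set_lebesgue_integral_def G_def ..
  also have "\<dots> = \<bar>1 / cos \<theta>\<bar> *\<^sub>R (LINT y|lborel. indicator {0<..} (0 + 1 / cos \<theta> * y) *\<^sub>R G (0 + 1 / cos \<theta> * y))"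
    using c by (intro lborel_integral_real_affine) auto
  also have "\<dots> = (LINT y|lborel. indicator {0<..} y *\<^sub>R (complex_of_real (1 / cos \<theta>) * G (y / cos \<theta>)))"
  proof -
    have "indicator {0<..} (0 + 1 / cos \<theta> * y) = (indicator {0<..} y :: real)" for y
      using c by (auto simp: indicator_def zero_less_mult_iff zero_less_divide_iff)
    then show ?thesis
      using c by (simp add: scaleR_conv_of_real mult_ac flip: integral_mult_right_zero)
  qed
  also have "\<dots> = (LINT y|lborel. indicator {0<..} y *\<^sub>R (complex_of_real C
      * (complex_of_real (y powr (\<nu> + 1 - p) * bessel_J \<nu> (y * (norm k * tan \<theta>)))
           * fourier1 (\<lambda>z. complex_of_real (f z)) (k, y))))"
  proof (intro Bochner_Integration.integral_cong refl)
    fix y :: real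
    show "indicator {0<..} y *\<^sub>R (complex_of_real (1 / cos \<theta>) * G (y / cos \<theta>))
        = indicator {0<..} y *\<^sub>R (complex_of_real C
      * (complex_of_real (y powr (\<nu> + 1 - p) * bessel_J \<nu> (y * (norm k * tan \<theta>)))
           * fourier1 (\<lambda>z. complex_of_real (f z)) (k, y)))"
    proof (cases "y > 0")
      case True
      define J where "J = bessel_J \<nu> (y * (norm k * tan \<theta>))"
      define r where "r = y * tan \<theta>"
      have r: "r > 0" "y / cos \<theta> * sin \<theta> = r" using t True by (simp add: r_def, simp add: r_def tan_def)
      have sph: "(LINT n|sphere_measure. exp (\<i> * complex_of_real (k \<bullet> (r *\<^sub>R n))))
          = complex_of_real ((2 * pi) powr (DIM('a) / 2) * (r * norm k) powr (- \<nu>) * J)"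
      proof -
        have "r *\<^sub>R k \<noteq> 0" using r(1) k by simp
        from sphere_fourier[OF this] show ?thesis
          using True t by (simp add: \<nu>_def J_def r_def mult_ac abs_mult)
      qed
      have const: "1 / cos \<theta> * ((y / cos \<theta>) powr (- p) * r ^ (DIM('a) - 1)
            * ((2 * pi) powr (DIM('a) / 2) * (r * norm k) powr (- \<nu>) * J))
          = C * (y powr (\<nu> + 1 - p) * J)"
      proof -
        have r_pow: "r ^ (DIM('a) - 1) = r powr (2 * \<nu> + 1)"
          using r by (subst powr_realpow[symmetric]) (auto simp: \<nu>_def of_nat_diff Suc_leI)
        have "r ^ (DIM('a) - 1) * (r * norm k) powr (- \<nu>)
            = (r powr (2 * \<nu> + 1) * r powr (- \<nu>)) * norm k powr (- \<nu>)"
          unfolding r_pow using r K by (simp add: powr_mult)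
        also have "r powr (2 * \<nu> + 1) * r powr (- \<nu>) = r powr (\<nu> + 1)"
          by (simp flip: powr_add)
        also have "r powr (\<nu> + 1) = y powr (\<nu> + 1) * tan \<theta> powr (DIM('a) / 2)"
          using True t by (simp add: r_def powr_mult \<nu>_def)
        finally have r_part: "r ^ (DIM('a) - 1) * (r * norm k) powr (- \<nu>)
             = y powr (\<nu> + 1) * tan \<theta> powr (DIM('a) / 2) / norm k powr \<nu>"
          by (simp add: powr_minus_divide)
        have cos_part: "1 / cos \<theta> * (y / cos \<theta>) powr (- p) = y powr (- p) / cos \<theta> powr (1 - p)"
        proof -
          have "(y / cos \<theta>) powr (- p) = y powr (- p) * cos \<theta> powr p"
            using True c by (simp add: powr_divide powr_minus field_simps)
          then have "1 / cos \<theta> * (y / cos \<theta>) powr (- p) = y powr (- p) * (cos \<theta> powr p / cos \<theta>)"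
            by (simp only: times_divide_eq_left times_divide_eq_right mult_1)
          also have "cos \<theta> powr p / cos \<theta> = 1 / cos \<theta> powr (1 - p)"
            using c by (simp add: powr_diff)
          finally show ?thesis by (simp only: times_divide_eq_right mult_1_right)
        qed
        have y_part: "y powr (\<nu> + 1) * y powr (- p) = y powr (\<nu> + 1 - p)"
          by (simp flip: powr_add)
        have "1 / cos \<theta> * ((y / cos \<theta>) powr (- p) * r ^ (DIM('a) - 1)
              * ((2 * pi) powr (DIM('a) / 2) * (r * norm k) powr (- \<nu>) * J))
            = (1 / cos \<theta> * (y / cos \<theta>) powr (- p)) * (r ^ (DIM('a) - 1) * (r * norm k) powr (- \<nu>))
              * ((2 * pi) powr (DIM('a) / 2) * J)"
          by (simp only: mult_ac)
        also have "\<dots> = C * ((y powr (\<nu> + 1) * y powr (- p)) * J)"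
          unfolding r_part cos_part C_def by (simp only: divide_inverse mult_ac)
        finally show ?thesis unfolding y_part .
      qed
      have "complex_of_real (1 / cos \<theta>) * G (y / cos \<theta>)
          = complex_of_real (1 / cos \<theta> * ((y / cos \<theta>) powr (- p) * r ^ (DIM('a) - 1)
            * ((2 * pi) powr (DIM('a) / 2) * (r * norm k) powr (- \<nu>) * J)))
            * fourier1 (\<lambda>z. complex_of_real (f z)) (k, y)"
        using c unfolding G_def r sph by (simp add: mult_ac)
      then show ?thesis
        unfolding const by (simp add: J_def mult_ac)
    qed simp
  qed
  also have "\<dots> = complex_of_real C
      * (LBINT y:{0<..}. complex_of_real (y powr (\<nu> + 1 - p) * bessel_J \<nu> (y * (norm k * tan \<theta>)))
           * fourier1 (\<lambda>z. complex_of_real (f z)) (k, y))"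
    unfolding set_lebesgue_integral_def by (simp flip: integral_mult_right_zero)
  finally show ?thesis unfolding C_def .
qed

text \<open>The weight \<open>y powr (\<nu> - p)\<close> does not depend on \<open>x\<close>, so it passes through the Fourier transform and
  combines with the factor \<open>y\<close> of the Hankel transform.\<close>

lemma hankel_fourier1_weighted:
  fixes f :: "'a::euclidean_space \<times> real \<Rightarrow> real"
  shows "hankel \<nu> (fourier1 (\<lambda>(x, y). complex_of_real (y powr (\<nu> - p) * f (x, y)))) (k, t)
    = (LBINT y:{0<..}. complex_of_real (y powr (\<nu> + 1 - p) * bessel_J \<nu> (y * t))
           * fourier1 (\<lambda>z. complex_of_real (f z)) (k, y))"
  unfolding hankel_def set_lebesgue_integral_def prod.case
proof (intro Bochner_Integration.integral_cong refl)
  fix y :: real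
  have "fourier1 (\<lambda>(x, y). complex_of_real (y powr (\<nu> - p) * f (x, y))) (k, y)
      = complex_of_real (y powr (\<nu> - p)) * fourier1 (\<lambda>z. complex_of_real (f z)) (k, y)"
    unfolding fourier1_def prod.case by (simp add: mult_ac flip: integral_mult_right_zero)
  moreover have "y powr (\<nu> + 1 - p) = y powr (\<nu> - p) * y" if "y > 0"
    using that powr_add[of y "\<nu> - p" 1] by (simp add: algebra_simps)
  ultimately show "indicator {0<..} y *\<^sub>R (complex_of_real (bessel_J \<nu> (y * t))
        * fourier1 (\<lambda>(x, y). complex_of_real (y powr (\<nu> - p) * f (x, y))) (k, y) * complex_of_real y)
      = indicator {0<..} y *\<^sub>R (complex_of_real (y powr (\<nu> + 1 - p) * bessel_J \<nu> (y * t))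
           * fourier1 (\<lambda>z. complex_of_real (f z)) (k, y))"
    by (cases "y > 0") (simp_all add: mult_ac)
qed

theorem theorem1p3:
  fixes d :: nat and p \<theta> :: real
    and f :: "(real ^ 'n) \<times> real \<Rightarrow> real"
    and k :: "real ^ 'n"
  assumes "d \<ge> 2" and "CARD('n) = d - 1"
    and "f \<in> test_functions (UNIV \<times> {0<..})"
    and "k \<noteq> 0"
    and "0 < \<theta>" and "\<theta> < pi / 2"
  shows "hankel ((real d - 3) / 2)
           (fourier1 (\<lambda>(x, y). complex_of_real (y powr ((real d - 3) / 2 - p) * f (x, y))))
           (k, norm k * tan \<theta>)
         = complex_of_real
             ((2 * pi) powr ((1 - real d) / 2)
              * (cos \<theta> powr (1 - p) / tan \<theta> powr ((real d - 1) / 2))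
              * norm k powr ((real d - 3) / 2))
           * fourier1 (\<lambda>z. complex_of_real (conical_radon p f z)) (k, \<theta>)"
proof -
  define \<nu> where "\<nu> = (real d - 3) / 2"
  have dim: "real DIM(real ^ 'n) / 2 = (real d - 1) / 2" "real DIM(real ^ 'n) / 2 - 1 = \<nu>"
    using assms(1,2) by (simp_all add: \<nu>_def of_nat_diff field_simps)
  have c: "cos \<theta> > 0" using assms by (intro cos_gt_zero) auto
  have t: "tan \<theta> > 0" using assms by (intro tan_gt_zero) auto
  have inv: "(2 * pi) powr ((1 - real d) / 2) = 1 / (2 * pi) powr ((real d - 1) / 2)"
  proof -
    have "(1 - real d) / 2 = - ((real d - 1) / 2)" by (simp add: field_simps)
    then show ?thesis by (simp only: powr_minus_divide)
  qed
  have one: "(2 * pi) powr ((1 - real d) / 2)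
      * (cos \<theta> powr (1 - p) / tan \<theta> powr ((real d - 1) / 2)) * norm k powr \<nu>
      * ((2 * pi) powr ((real d - 1) / 2) * tan \<theta> powr ((real d - 1) / 2)
                         / cos \<theta> powr (1 - p) / norm k powr \<nu>) = 1"
    unfolding inv using c t \<open>k \<noteq> 0\<close> by simp
  have cancel: "X = complex_of_real a * (complex_of_real b * X)" if "a * b = 1" for a b X
    by (metis mult.assoc mult_1 of_real_1 of_real_mult that)
  note radon = fourier_conical_radon_bessel[OF assms(3,5,6,4), of p, unfolded dim(2), unfolded dim(1)]
  show ?thesis
    unfolding radon \<nu>_def[symmetric] hankel_fourier1_weighted by (rule cancel[OF one])
qed

end
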